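(* The cycle $C_5$ on five vertices is a Kirchhoff Šoltés graph, i.e. $Kf(C_5)=Kf(C_5-v)$ for every vertex $v\in V(C_5)$.
   Context: All graphs are finite, simple, undirected and connected. For vertices $a,b$ of a connected graph $G$, the resistance distance $\Omega_G(a,b)$ is the effective resistance between $a$ and $b$ in the electrical network obtained from $G$ by replacing each edge by a unit resistor; equivalently $\Omega_G(a,b)=(e_a-e_b)^{T}L^{\dagger}(e_a-e_b)$, where $L$ is the Laplacian matrix of $G$, $L^{\dagger}$ its Moore–Penrose inverse, and $e_a$ the standard unit vector indexed by $a$. The Kirchhoff index of a connected graph $G$ is $Kf(G)=\sum_{\{u,v\}\subseteq V(G)}\Omega_G(u,v)$, the sum over unordered pairs of distinct vertices. $G-v$ denotes the graph obtained from $G$ by deleting the vertex $v$ and its incident edges. A vertex $v$ of $G$ is good if $G-v$ is connected and $Kf(G)=Kf(G-v)$ (cut vertices are not good). A Kirchhoff Šoltés graph is a graph all of whose vertices are good. *)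

theory Defs
  imports
    Complex_Main
    "Graph_Theory.Digraph_Component"
begin

text \<open>
  Matrices indexed by a finite set V are functions on pairs of indices. Deleting a vertex
  changes V but not the type of vertices. Only the entries with both indices in V matter.
\<close>

definition mat_mult_on ::
    "'a set \<Rightarrow> ('a \<Rightarrow> 'a \<Rightarrow> real) \<Rightarrow> ('a \<Rightarrow> 'a \<Rightarrow> real) \<Rightarrow> 'a \<Rightarrow> 'a \<Rightarrow> real" where
  "mat_mult_on V A B i j = (\<Sum>k\<in>V. A i k * B k j)"

definition is_mp_inverse_on :: "'a set \<Rightarrow> ('a \<Rightarrow> 'a \<Rightarrow> real) \<Rightarrow> ('a \<Rightarrow> 'a \<Rightarrow> real) \<Rightarrow> bool" where
  "is_mp_inverse_on V A B \<longleftrightarrow> (\<forall>i\<in>V. \<forall>j\<in>V.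
     mat_mult_on V (mat_mult_on V A B) A i j = A i j \<and>
     mat_mult_on V (mat_mult_on V B A) B i j = B i j \<and>
     mat_mult_on V A B j i = mat_mult_on V A B i j \<and>
     mat_mult_on V B A j i = mat_mult_on V B A i j)"

text \<open>
  The Penrose equations determine the entries inside V only; the value 0 outside V
  makes the description unique.
\<close>

definition mp_inverse_on :: "'a set \<Rightarrow> ('a \<Rightarrow> 'a \<Rightarrow> real) \<Rightarrow> 'a \<Rightarrow> 'a \<Rightarrow> real" where
  "mp_inverse_on V A =
     (THE B. is_mp_inverse_on V A B \<and> (\<forall>i j. i \<notin> V \<or> j \<notin> V \<longrightarrow> B i j = 0))"

lemma mat_mult_on_assoc:
  "mat_mult_on V (mat_mult_on V A B) C = mat_mult_on V A (mat_mult_on V B C)"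
proof (intro ext)
  fix i j
  have "mat_mult_on V (mat_mult_on V A B) C i j = (\<Sum>l\<in>V. \<Sum>k\<in>V. A i k * (B k l * C l j))"
    by (simp add: mat_mult_on_def sum_distrib_right mult.assoc)
  also have "\<dots> = (\<Sum>k\<in>V. \<Sum>l\<in>V. A i k * (B k l * C l j))"
    by (rule sum.swap)
  finally show "mat_mult_on V (mat_mult_on V A B) C i j = mat_mult_on V A (mat_mult_on V B C) i j"
    by (simp add: mat_mult_on_def sum_distrib_left)
qed

lemma mat_mult_on_cong:
  assumes "\<And>k. k \<in> V \<Longrightarrow> A i k = A' i k" "\<And>k. k \<in> V \<Longrightarrow> B k j = B' k j"
  shows "mat_mult_on V A B i j = mat_mult_on V A' B' i j"
  using assms by (simp add: mat_mult_on_def)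

lemma mat_mult_on_transpose:
  "mat_mult_on V A B i j = mat_mult_on V (\<lambda>i j. B j i) (\<lambda>i j. A j i) j i"
  by (simp add: mat_mult_on_def mult.commute)

lemma is_mp_inverse_on_unique:
  assumes B: "is_mp_inverse_on V A B" and C: "is_mp_inverse_on V A C" and ij: "i \<in> V" "j \<in> V"
  shows "B i j = C i j"
proof -
  let ?m = "mat_mult_on V"
  note eqs = B[unfolded is_mp_inverse_on_def] C[unfolded is_mp_inverse_on_def]
  have AB: "?m A B i j = ?m A C i j" if "i \<in> V" "j \<in> V" for i j
  proof -
    have "?m A B i j = ?m (?m (?m A C) A) B i j"
      by (rule mat_mult_on_cong) (use eqs that in auto)
    also have "\<dots> = ?m (?m A C) (?m A B) i j"
      by (simp add: mat_mult_on_assoc)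
    also have "\<dots> = ?m (\<lambda>i j. ?m A C j i) (\<lambda>i j. ?m A B j i) i j"
      by (rule mat_mult_on_cong) (use eqs that in auto)
    also have "\<dots> = ?m (?m A B) (?m A C) j i"
      by (rule mat_mult_on_transpose[symmetric])
    also have "\<dots> = ?m (?m (?m A B) A) C j i"
      by (simp add: mat_mult_on_assoc)
    also have "\<dots> = ?m A C j i"
      by (rule mat_mult_on_cong) (use eqs that in auto)
    also have "\<dots> = ?m A C i j"
      using eqs that by blast
    finally show ?thesis .
  qed
  have BA: "?m B A i j = ?m C A i j" if "i \<in> V" "j \<in> V" for i j
  proof -
    have "?m B A i j = ?m B (?m A (?m C A)) i j"
      by (rule mat_mult_on_cong) (use eqs that in \<open>auto simp: mat_mult_on_assoc\<close>)
    also have "\<dots> = ?m (?m B A) (?m C A) i j"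
      by (simp add: mat_mult_on_assoc)
    also have "\<dots> = ?m (\<lambda>i j. ?m B A j i) (\<lambda>i j. ?m C A j i) i j"
      by (rule mat_mult_on_cong) (use eqs that in auto)
    also have "\<dots> = ?m (?m C A) (?m B A) j i"
      by (rule mat_mult_on_transpose[symmetric])
    also have "\<dots> = ?m C (?m (?m A B) A) j i"
      by (simp add: mat_mult_on_assoc)
    also have "\<dots> = ?m C A j i"
      by (rule mat_mult_on_cong) (use eqs that in auto)
    also have "\<dots> = ?m C A i j"
      using eqs that by blast
    finally show ?thesis .
  qed
  have "B i j = ?m (?m B A) B i j" using eqs ij by auto
  also have "\<dots> = ?m (?m C A) B i j" by (rule mat_mult_on_cong) (use BA ij in auto)
  also have "\<dots> = ?m C (?m A B) i j" by (simp add: mat_mult_on_assoc)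
  also have "\<dots> = ?m C (?m A C) i j" by (rule mat_mult_on_cong) (use AB ij in auto)
  also have "\<dots> = ?m (?m C A) C i j" by (simp add: mat_mult_on_assoc)
  also have "\<dots> = C i j" using eqs ij by auto
  finally show ?thesis .
qed

lemma mp_inverse_on_eqI:
  assumes "is_mp_inverse_on V A B" "\<And>i j. i \<notin> V \<or> j \<notin> V \<Longrightarrow> B i j = 0"
  shows "mp_inverse_on V A = B"
  unfolding mp_inverse_on_def
proof (rule the_equality)
  show "is_mp_inverse_on V A B \<and> (\<forall>i j. i \<notin> V \<or> j \<notin> V \<longrightarrow> B i j = 0)"
    using assms by blast
next
  fix C
  assume C: "is_mp_inverse_on V A C \<and> (\<forall>i j. i \<notin> V \<or> j \<notin> V \<longrightarrow> C i j = 0)"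
  show "C = B"
  proof (intro ext)
    fix i j
    show "C i j = B i j"
      using C assms is_mp_inverse_on_unique[of V A C B i j] by (cases "i \<in> V \<and> j \<in> V") auto
  qed
qed

text \<open>
  A finite simple undirected graph is a digraph satisfying \<^locale>\<open>graph\<close>: every edge is
  represented by its two orientations, so the out-degree is the degree.
\<close>

definition laplacian :: "('a, 'b) pre_digraph \<Rightarrow> 'a \<Rightarrow> 'a \<Rightarrow> real" where
  "laplacian G i j =
     (if i = j then real (out_degree G i) else if i \<rightarrow>\<^bsub>G\<^esub> j then -1 else 0)"

definition unit_vec :: "'a \<Rightarrow> 'a \<Rightarrow> real" where
  "unit_vec a i = (if i = a then 1 else 0)"

definition resistance_distance :: "('a, 'b) pre_digraph \<Rightarrow> 'a \<Rightarrow> 'a \<Rightarrow> real" where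
  "resistance_distance G a b =
     (\<Sum>i\<in>verts G. \<Sum>j\<in>verts G.
        (unit_vec a i - unit_vec b i) * mp_inverse_on (verts G) (laplacian G) i j *
        (unit_vec a j - unit_vec b j))"

lemma resistance_distance_commute:
  "resistance_distance G a b = resistance_distance G b a"
  unfolding resistance_distance_def by (intro sum.cong refl) (simp add: algebra_simps)

text \<open>
  Every unordered pair of distinct vertices is counted twice by the sum over ordered pairs,
  hence the factor 1/2; see \<open>kirchhoff_index_unordered\<close>.
\<close>

definition kirchhoff_index :: "('a, 'b) pre_digraph \<Rightarrow> real" where
  "kirchhoff_index G =
     (\<Sum>(u, v) \<in> {(u, v). u \<in> verts G \<and> v \<in> verts G \<and> u \<noteq> v}. resistance_distance G u v) / 2"

lemma kirchhoff_index_unordered: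
  assumes fin: "finite (verts G)"
    and f: "\<And>u v. u \<in> verts G \<Longrightarrow> v \<in> verts G \<Longrightarrow> f {u, v} = resistance_distance G u v"
  shows "kirchhoff_index G = (\<Sum>e | e \<subseteq> verts G \<and> card e = 2. f e)"
proof -
  let ?P = "{(u, v). u \<in> verts G \<and> v \<in> verts G \<and> u \<noteq> v}"
  let ?E = "{e. e \<subseteq> verts G \<and> card e = 2}"
  let ?h = "\<lambda>(u, v). {u, v}"
  have finP: "finite ?P" by (rule finite_subset[of _ "verts G \<times> verts G"]) (use fin in auto)
  have finE: "finite ?E" using fin by simp
  have img: "?h ` ?P \<subseteq> ?E" by auto
  have "(\<Sum>(u, v) \<in> ?P. resistance_distance G u v) = (\<Sum>p \<in> ?P. f (?h p))"
    by (intro sum.cong) (auto simp: f)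
  also have "\<dots> = (\<Sum>e \<in> ?E. \<Sum>p \<in> {p \<in> ?P. ?h p = e}. f (?h p))"
    by (rule sum.group[OF finP finE img, symmetric])
  also have "\<dots> = (\<Sum>e \<in> ?E. 2 * f e)"
  proof (intro sum.cong refl)
    fix e assume "e \<in> ?E"
    then obtain a b where ab: "e = {a, b}" "a \<noteq> b" "a \<in> verts G" "b \<in> verts G"
      by (auto simp: card_2_iff)
    then have "{p \<in> ?P. ?h p = e} = {(a, b), (b, a)}"
      by (auto simp: doubleton_eq_iff)
    with ab show "(\<Sum>p \<in> {p \<in> ?P. ?h p = e}. f (?h p)) = 2 * f e"
      by (simp add: insert_commute)
  qed
  finally show ?thesis
    by (simp add: kirchhoff_index_def flip: sum_distrib_left)
qed

text \<open>
  Connectedness is qualified because \<^const>\<open>Topological_Spaces.connected\<close> has the same base name.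
\<close>

definition good_vertex :: "('a, 'b) pre_digraph \<Rightarrow> 'a \<Rightarrow> bool" where
  "good_vertex G v \<longleftrightarrow>
     Digraph_Component.connected (pre_digraph.del_vert G v) \<and>
     kirchhoff_index G = kirchhoff_index (pre_digraph.del_vert G v)"

definition kirchhoff_soltes_graph :: "('a, 'b) pre_digraph \<Rightarrow> bool" where
  "kirchhoff_soltes_graph G \<longleftrightarrow>
     graph G \<and> Digraph_Component.connected G \<and> (\<forall>v\<in>verts G. good_vertex G v)"

text \<open>The cycle on n vertices 0 to n - 1, meaningful for n at least 3.\<close>

definition cycle_graph :: "nat \<Rightarrow> (nat, nat \<times> nat) pre_digraph" where
  "cycle_graph n = with_proj
     \<lparr> pverts = {..<n},
       parcs = {(i, j). i < n \<and> j < n \<and> (j = Suc i mod n \<or> i = Suc j mod n)} \<rparr>"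

end

theory Submission
  imports Defs
begin

text \<open>
  If B is symmetric with zero row sums and L B = I - J/n, where J is the all-ones matrix, then B is
  the Moore-Penrose inverse of the Laplacian L. Moreover G is then connected: summing the rows of
  L B over a component S annihilates L, so the corresponding sum for I - J/n forces S to
  contain all n vertices. Since B has zero row sums, Kf(G) = n tr(B). Such matrices B exist
  for the 5-cycle, with trace 2, and for the path on 4 vertices, with trace 5/2, so both
  Kirchhoff indices equal 10.
\<close>

definition green_function :: "('a, 'b) pre_digraph \<Rightarrow> ('a \<Rightarrow> 'a \<Rightarrow> real) \<Rightarrow> bool" where
  "green_function G B \<longleftrightarrow>
     (\<forall>i\<in>verts G. \<forall>j\<in>verts G. B i j = B j i) \<and>
     (\<forall>i\<in>verts G. (\<Sum>j\<in>verts G. B i j) = 0) \<and>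
     (\<forall>i\<in>verts G. \<forall>j\<in>verts G.
        (\<Sum>k\<in>verts G. if i \<rightarrow>\<^bsub>G\<^esub> k then B i j - B k j else 0) =
        (if i = j then 1 else 0) - 1 / card (verts G))"

section \<open>The Laplacian as a difference operator\<close>

lemma (in sym_digraph) dominates_commute: "i \<rightarrow>\<^bsub>G\<^esub> j \<longleftrightarrow> j \<rightarrow>\<^bsub>G\<^esub> i"
  using arcs_ends_symmetric[OF sym_arcs] by blast

lemma (in graph) out_degree_eq_sum:
  "real (out_degree G i) = (\<Sum>k\<in>verts G. if i \<rightarrow>\<^bsub>G\<^esub> k then 1 else 0)"
proof -
  have "inj_on (head G) (out_arcs G i)"
    by (auto simp: inj_on_def out_arcs_def arc_to_ends_def intro!: no_multi_arcs)
  moreover have "head G ` out_arcs G i = {k \<in> verts G. i \<rightarrow>\<^bsub>G\<^esub> k}"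
    by (auto simp: arcs_ends_def arc_to_ends_def)
  ultimately have "out_degree G i = card {k \<in> verts G. i \<rightarrow>\<^bsub>G\<^esub> k}"
    unfolding out_degree_def by (metis card_image)
  then show ?thesis
    by (simp add: sum.If_cases Int_def)
qed

text \<open>Links the Laplacian to the third clause of \<open>green_function\<close>, where degrees
  no longer occur: a concrete matrix can then be checked from adjacency alone.\<close>

lemma (in graph) laplacian_mult:
  assumes "i \<in> verts G"
  shows "(\<Sum>k\<in>verts G. laplacian G i k * f k) = (\<Sum>k\<in>verts G. if i \<rightarrow>\<^bsub>G\<^esub> k then f i - f k else 0)"
proof -
  \<comment> \<open>Without a loop at \<open>i\<close>, the diagonal term and the adjacency term
    never overlap.\<close>
  have "\<not> i \<rightarrow>\<^bsub>G\<^esub> i"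
    using adj_not_same by blast
  then have "laplacian G i k * f k = (if k = i then out_degree G i * f i else 0)
      - (if i \<rightarrow>\<^bsub>G\<^esub> k then f k else 0)" for k
    by (auto simp: laplacian_def)
  then have "(\<Sum>k\<in>verts G. laplacian G i k * f k) =
      real (out_degree G i) * f i - (\<Sum>k\<in>verts G. if i \<rightarrow>\<^bsub>G\<^esub> k then f k else 0)"
    using assms by (simp add: sum_subtractf)
  also have "\<dots> = (\<Sum>k\<in>verts G. if i \<rightarrow>\<^bsub>G\<^esub> k then f i - f k else 0)"
    unfolding out_degree_eq_sum sum_distrib_right sum_subtractf[symmetric]
    by (intro sum.cong) auto
  finally show ?thesis .
qed

lemma (in graph) laplacian_commute: "laplacian G i j = laplacian G j i"
  using dominates_commute by (auto simp: laplacian_def)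

lemma (in graph) laplacian_col_sum:
  assumes "j \<in> verts G"
  shows "(\<Sum>k\<in>verts G. laplacian G k j) = 0"
  using laplacian_mult[OF assms, of "\<lambda>_. 1"] by (simp add: laplacian_commute cong: if_cong)

section \<open>Resistance distance and Kirchhoff index from a Green function\<close>

text \<open>Transposing L B = I - J/n gives B L = I - J/n, so both products are symmetric.
  Multiplying by I - J/n from the left subtracts the column means, which vanish for L and for
  B.\<close>

lemma (in graph) is_mp_inverse_on_green_function:
  assumes B: "green_function G B"
  shows "is_mp_inverse_on (verts G) (laplacian G) B"
proof -
  let ?L = "laplacian G" and ?m = "mat_mult_on (verts G)"
  let ?E = "\<lambda>i j. (if i = j then 1 else 0) - 1 / real (card (verts G))"
  have E_mult: "?m ?E A i j = A i j - (\<Sum>k\<in>verts G. A k j) / card (verts G)"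
    if "i \<in> verts G" for A i j
    using that
    by (simp add: mat_mult_on_def left_diff_distrib sum_subtractf sum_divide_distrib
        if_distrib[of "\<lambda>x. x * _"] cong: if_cong)
  have LB: "?m ?L B i j = ?E i j" if "i \<in> verts G" "j \<in> verts G" for i j
    using B that by (simp add: mat_mult_on_def laplacian_mult green_function_def)
  have BL: "?m B ?L i j = ?E i j" if "i \<in> verts G" "j \<in> verts G" for i j
  proof -
    have "?m B ?L i j = ?m ?L B j i"
      unfolding mat_mult_on_transpose[of _ B] using B that
      by (intro mat_mult_on_cong) (auto simp: laplacian_commute green_function_def)
    then show ?thesis
      using LB that by auto
  qed
  have col: "(\<Sum>k\<in>verts G. B k j) = 0" if "j \<in> verts G" for j
  proof -
    have "(\<Sum>k\<in>verts G. B k j) = (\<Sum>k\<in>verts G. B j k)"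
      using B that by (intro sum.cong) (auto simp: green_function_def)
    also have "\<dots> = 0"
      using B that unfolding green_function_def by blast
    finally show ?thesis .
  qed
  show ?thesis
    unfolding is_mp_inverse_on_def
  proof (intro ballI conjI)
    fix i j assume ij: "i \<in> verts G" "j \<in> verts G"
    have "?m (?m ?L B) ?L i j = ?m ?E ?L i j"
      using LB ij by (intro mat_mult_on_cong) auto
    then show "?m (?m ?L B) ?L i j = ?L i j"
      using ij by (simp add: E_mult laplacian_col_sum)
    have "?m (?m B ?L) B i j = ?m ?E B i j"
      using BL ij by (intro mat_mult_on_cong) auto
    then show "?m (?m B ?L) B i j = B i j"
      using ij by (simp add: E_mult col)
    show "?m ?L B j i = ?m ?L B i j" "?m B ?L j i = ?m B ?L i j"
      using LB BL ij by auto
  qed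
qed

lemma (in graph) resistance_distance_green_function:
  assumes B: "green_function G B" and ab: "a \<in> verts G" "b \<in> verts G"
  shows "resistance_distance G a b = B a a + B b b - 2 * B a b"
proof -
  \<comment> \<open>\<open>mp_inverse_on\<close> selects the matrix that vanishes outside the vertex
    set, so B is cut off there.\<close>
  let ?B = "\<lambda>i j. if i \<in> verts G \<and> j \<in> verts G then B i j else 0"
  have "is_mp_inverse_on (verts G) (laplacian G) ?B"
    using is_mp_inverse_on_green_function[OF B]
    by (simp add: is_mp_inverse_on_def mat_mult_on_def)
  then have "mp_inverse_on (verts G) (laplacian G) = ?B"
    by (rule mp_inverse_on_eqI) auto
  then have "resistance_distance G a b = (\<Sum>i\<in>verts G. \<Sum>j\<in>verts G.
      (unit_vec a i - unit_vec b i) * B i j * (unit_vec a j - unit_vec b j))"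
    unfolding resistance_distance_def by (intro sum.cong) auto
  also have "\<dots> = (\<Sum>i\<in>verts G. (unit_vec a i - unit_vec b i) * (B i a - B i b))"
    using ab
    by (intro sum.cong refl)
      (simp add: unit_vec_def right_diff_distrib sum_subtractf
        if_distrib[of "\<lambda>x. _ * x"] cong: if_cong)
  also have "\<dots> = (B a a - B a b) - (B b a - B b b)"
    using ab
    by (simp add: unit_vec_def left_diff_distrib sum_subtractf
        if_distrib[of "\<lambda>x. x * _"] cong: if_cong)
  finally show ?thesis
    using B ab by (simp add: green_function_def)
qed

lemma (in graph) kirchhoff_index_green_function:
  fixes B :: "'a \<Rightarrow> 'a \<Rightarrow> real"
  assumes B: "green_function G B"
  shows "kirchhoff_index G = card (verts G) * (\<Sum>i\<in>verts G. B i i)"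
proof -
  let ?V = "verts G"
  \<comment> \<open>The added diagonal pairs contribute B u u + B u u - 2 B u u = 0.\<close>
  have "(\<Sum>(u, v) \<in> {(u, v). u \<in> ?V \<and> v \<in> ?V \<and> u \<noteq> v}. resistance_distance G u v) =
      (\<Sum>(u, v) \<in> ?V \<times> ?V. resistance_distance G u v)"
    by (rule sum.mono_neutral_left) (auto simp: resistance_distance_green_function[OF B])
  also have "\<dots> = (\<Sum>u\<in>?V. \<Sum>v\<in>?V. B u u + B v v - 2 * B u v)"
    by (simp add: resistance_distance_green_function[OF B] flip: sum.cartesian_product)
  \<comment> \<open>The mixed terms B u v disappear because the row sums are zero.\<close>
  also have "\<dots> = (\<Sum>u\<in>?V. card ?V * B u u + (\<Sum>v\<in>?V. B v v))"
    using B by (intro sum.cong refl)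
      (simp add: sum.distrib sum_subtractf green_function_def flip: sum_distrib_left)
  also have "\<dots> = 2 * (card ?V * (\<Sum>i\<in>?V. B i i))"
    by (simp add: sum.distrib flip: sum_distrib_left)
  finally show ?thesis
    by (simp add: kirchhoff_index_def)
qed

section \<open>Connectedness from a Green function\<close>

lemma (in graph) connected_green_function:
  assumes B: "green_function G B" and ne: "verts G \<noteq> {}"
  shows "Digraph_Component.connected G"
proof -
  have "u \<rightarrow>\<^sup>* v" if u: "u \<in> verts G" and v: "v \<in> verts G" for u v
  proof -
    let ?V = "verts G" and ?S = "{w \<in> verts G. u \<rightarrow>\<^sup>* w}"
    let ?f = "\<lambda>i k. if i \<rightarrow>\<^bsub>G\<^esub> k then B i u - B k u else 0"
    have closed: "k \<in> ?S" if "i \<in> ?S" "i \<rightarrow>\<^bsub>G\<^esub> k" for i k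
      using that reachable_adj_trans adj_in_verts by auto
    have swap: "?f k i = - ?f i k" for i k
      using dominates_commute[of i k] by simp
    \<comment> \<open>No arc leaves \<open>?S\<close>, so the inner sum may be restricted to
      it.\<close>
    have "(\<Sum>i\<in>?S. \<Sum>k\<in>?V. ?f i k) = (\<Sum>i\<in>?S. \<Sum>k\<in>?S. ?f i k)"
    proof (rule sum.cong[OF refl], rule sum.mono_neutral_right)
      show "\<forall>k\<in>?V - ?S. ?f i k = 0" if "i \<in> ?S" for i
        using closed[OF that] by (metis DiffD2)
    qed auto
    \<comment> \<open>Exchanging the summations and using the antisymmetry of \<open>?f\<close>
      shows that the sum equals its own negative.\<close>
    moreover have "(\<Sum>i\<in>?S. \<Sum>k\<in>?S. ?f i k) = (\<Sum>i\<in>?S. \<Sum>k\<in>?S. - ?f i k)"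
      by (subst sum.swap) (rule sum.cong[OF refl], rule sum.cong[OF refl], rule swap)
    then have "(\<Sum>i\<in>?S. \<Sum>k\<in>?S. ?f i k) = - (\<Sum>i\<in>?S. \<Sum>k\<in>?S. ?f i k)"
      by (simp only: sum_negf)
    ultimately have "(\<Sum>i\<in>?S. \<Sum>k\<in>?V. ?f i k) = 0"
      by linarith
    \<comment> \<open>This is column \<open>u\<close> of L B = I - J/n, summed over the rows in
      \<open>?S\<close>; since \<open>u\<close> lies in \<open>?S\<close>, the identity part
      contributes 1.\<close>
    then have "(\<Sum>i\<in>?S. (if i = u then 1 else 0) - 1 / real (card ?V)) = 0"
      using B u by (simp add: green_function_def)
    then have "1 - real (card ?S) / real (card ?V) = 0"
      using u by (auto simp: sum_subtractf)
    then have "card ?S = card ?V"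
      using u by (auto simp: field_simps)
    then have "?S = ?V"
      by (intro card_subset_eq) auto
    then show ?thesis
      using v by auto
  qed
  then show ?thesis
    using ne reachable_mk_symmetric_eq[OF sym_arcs]
    by (simp add: Digraph_Component.connected_def strongly_connected_def)
qed

section \<open>Vertex deletion and cycles as graphs\<close>

lemma arcs_ends_del_vert:
  "arcs_ends (pre_digraph.del_vert G v) = {(i, j). i \<rightarrow>\<^bsub>G\<^esub> j \<and> i \<noteq> v \<and> j \<noteq> v}"
  by (auto simp: arcs_ends_conv pre_digraph.del_vert_simps)

lemma (in graph) graph_del_vert: "graph (del_vert v)"
proof -
  interpret D: fin_digraph "del_vert v"
    by (rule fin_digraph_del_vert)
  show ?thesis
  proof
    show "symmetric (del_vert v)"
      using dominates_commute by (auto simp: symmetric_def arcs_ends_del_vert sym_def)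
  qed (auto simp: pre_digraph.del_vert_simps pre_digraph.ends_del_vert dest: no_loops no_multi_arcs)
qed

lemma graph_cycle_graph:
  assumes "n \<ge> 2"
  shows "graph (cycle_graph n)"
proof
  show "finite (arcs (cycle_graph n))"
    by (rule finite_subset[of _ "{..<n} \<times> {..<n}"]) (auto simp: cycle_graph_def)
  \<comment> \<open>For n = 1 the successor of 0 modulo n is 0 itself, a loop; n \<ge> 2 excludes
    this.\<close>
  show "tail (cycle_graph n) e \<noteq> head (cycle_graph n) e" if "e \<in> arcs (cycle_graph n)" for e
    using that assms by (auto simp: cycle_graph_def mod_Suc split: if_splits)
qed (auto simp: cycle_graph_def symmetric_def sym_def arc_to_ends_def)

section \<open>The 5-cycle and its vertex-deleted paths\<close>

lemma lessThan_5: "{..<5} = {0, 1, 2, 3, 4 :: nat}"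
  by auto

text \<open>Trades modular arithmetic for an explicit list, so that the later checks are finite
  evaluations.\<close>

lemma dominates_cycle_graph_5:
  "i \<rightarrow>\<^bsub>cycle_graph 5\<^esub> j \<longleftrightarrow> (i, j) \<in>
     {(0,1), (1,2), (2,3), (3,4), (4,0), (1,0), (2,1), (3,2), (4,3), (0,4)}"
proof -
  consider "i \<in> {0, 1, 2, 3, 4}" "j \<in> {0, 1, 2, 3, 4}" | "\<not> (i < 5 \<and> j < 5)"
    unfolding lessThan_5[symmetric] by auto
  then show ?thesis
  proof cases
    case 1
    then show ?thesis
      by (elim insertE) (simp_all add: cycle_graph_def)
  qed (auto simp: cycle_graph_def)
qed

text \<open>Vertices of the 5-cycle at distance d have resistance d(5-d)/5, that is 0, 4/5 or 6/5,
  with average 4/5 in each row. Double centring of -1/2 times this matrix gives (4/5 -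
  resistance)/2, hence 2/5, 0 and -1/5.\<close>

definition green_cycle :: "nat \<Rightarrow> nat \<Rightarrow> real" where
  "green_cycle i j = (if i = j then 2/5 else if i \<rightarrow>\<^bsub>cycle_graph 5\<^esub> j then 0 else - 1/5)"

lemma green_function_cycle_graph: "green_function (cycle_graph 5) green_cycle"
proof -
  have V: "verts (cycle_graph 5) = {0, 1, 2, 3, 4}"
    by (simp add: cycle_graph_def lessThan_5)
  show ?thesis
    unfolding green_function_def V green_cycle_def dominates_cycle_graph_5 by simp
qed

text \<open>
  The vertices of the path left after deleting v are numbered by p = i - v - 1 modulo 5, so that
  p runs from 0 to 3. The resistance distance in the path is the difference of positions, and
  double centring of -1/2 times the distance matrix gives the Moore-Penrose inverse: the average
  distance from p is 3/2 at the ends and 1 inside, the overall average is 5/4.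
\<close>

definition green_path :: "nat \<Rightarrow> nat \<Rightarrow> nat \<Rightarrow> real" where
  "green_path v i j =
     (let p = (i + 4 - v) mod 5; q = (j + 4 - v) mod 5;
          r = (\<lambda>p. if p = 0 \<or> p = 3 then 3/2 else 1)
      in (r p + r q - 5/4 - \<bar>real p - real q\<bar>) / 2)"

text \<open>As v \<le> 4, the natural subtraction in \<open>i + 4 - v\<close> does not truncate. The
  diagonal entries are 7/8 at the two ends and 3/8 at the two inner vertices, which gives the
  trace.\<close>

lemma
  assumes "v < 5"
  shows green_function_del_vert_cycle_graph:
      "green_function (pre_digraph.del_vert (cycle_graph 5) v) (green_path v)"
    and trace_green_path: "(\<Sum>i\<in>{..<5} - {v}. green_path v i i) = 5/2"
proof -
  have v: "v \<in> {0, 1, 2, 3, 4}"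
    using assms by auto
  have V: "verts (pre_digraph.del_vert (cycle_graph 5) v) = {0, 1, 2, 3, 4} - {v}"
    by (simp add: pre_digraph.verts_del_vert cycle_graph_def lessThan_5)
  show "green_function (pre_digraph.del_vert (cycle_graph 5) v) (green_path v)"
    using v unfolding green_function_def V arcs_ends_del_vert mem_Collect_eq case_prod_conv
      dominates_cycle_graph_5
    \<comment> \<open>For each v the vertex set is made explicit first; only then are the matrix
      entries evaluated.\<close>
    by (elim insertE; simp add: insert_Diff_if; simp add: green_path_def)
  show "(\<Sum>i\<in>{..<5} - {v}. green_path v i i) = 5/2"
    using v unfolding lessThan_5
    by (elim insertE; simp add: insert_Diff_if; simp add: green_path_def)
qed

theorem proposition6:
  shows "kirchhoff_soltes_graph (cycle_graph 5)"
proof -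
  let ?C = "cycle_graph 5"
  interpret C: graph ?C
    by (rule graph_cycle_graph) simp
  have V: "verts ?C = {..<5}"
    by (simp add: cycle_graph_def)
  have "kirchhoff_index ?C = 10"
    by (simp add: C.kirchhoff_index_green_function[OF green_function_cycle_graph] V green_cycle_def)
  \<comment> \<open>The one matrix \<open>green_path v\<close> yields both connectedness and the
    index 4 * 5/2.\<close>
  moreover have "Digraph_Component.connected (C.del_vert v) \<and> kirchhoff_index (C.del_vert v) = 10"
    if "v \<in> verts ?C" for v
  proof -
    interpret D: graph "C.del_vert v"
      by (rule C.graph_del_vert)
    have v: "v < 5" and VD: "verts (C.del_vert v) = {..<5} - {v}"
      using that by (auto simp: V pre_digraph.verts_del_vert)
    then have card: "card (verts (C.del_vert v)) = 4"
      by simp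
    then have "verts (C.del_vert v) \<noteq> {}"
      by auto
    with card show ?thesis
      using green_function_del_vert_cycle_graph[OF v] D.connected_green_function
        D.kirchhoff_index_green_function trace_green_path[OF v] VD by simp
  qed
  ultimately show ?thesis
    using C.connected_green_function[OF green_function_cycle_graph] V C.graph_axioms
    by (auto simp: lessThan_5 kirchhoff_soltes_graph_def good_vertex_def)
qed

end
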